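(* Let $p$ be an odd prime and let $\chi$ be the canonical anti-automorphism of the Steenrod algebra $\mathcal{A}_p$. Then for every $n\ge 1$, in ${\bf P}=\mathbb{F}_p[x_1,\dots,x_n]$, $$\chi(P^{p_n-n})\,(x_1x_2\cdots x_n)^{p-1}=w(n)^{p-1},$$ where $p_n=(p^n-1)/(p-1)$ and $w(n)=\det\big(x_j^{p^{i-1}}\big)_{1\le i,j\le n}$.
   Context: ${\bf P}=\mathbb{F}_p[x_1,\dots,x_n]$ is graded with each $x_i$ in degree $1$. $\mathcal{A}_p$ is the algebra of Steenrod $p$th powers (mod $p$ Steenrod algebra without Bocksteins), generated by $P^r$, $r\ge 0$, $P^0=1$. It acts on ${\bf P}$ on the left by linear maps: $P^1x_i=x_i^p$, $P^rx_i=0$ for $r>1$, $P^r1=0$ for $r>0$, and the Cartan formula $P^r(fg)=\sum_{s+t=r}P^sf\cdot P^tg$ holds; $P^r$ raises polynomial degree by $r(p-1)$. The canonical anti-automorphism $\chi$ of $\mathcal{A}_p$ is determined by $\chi(1)=1$ and $\sum_{i+j=r}P^i\chi(P^j)=0$ for $r\ge1$. *)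

theory Defs
  imports
    "HOL-Library.Poly_Mapping"
    "Berlekamp_Zassenhaus.Finite_Field"
    "Jordan_Normal_Form.Determinant"
begin

text \<open>Throughout, \<open>'p\<close> is a type whose cardinality is the prime \<open>p\<close>, and
  \<open>'p mod_ring\<close> is the field with \<open>p\<close> elements.\<close>


section \<open>The polynomial algebra on \<open>x_1, ..., x_n\<close>\<close>

text \<open>Polynomials in countably many variables, as finitely supported functions from exponent
  vectors to coefficients; \<open>poly_alg n\<close> is the subalgebra of those in which only
  \<open>x_1, ..., x_n\<close> occur.\<close>

type_synonym 'p mpoly = "(nat \<Rightarrow>\<^sub>0 nat) \<Rightarrow>\<^sub>0 'p mod_ring"

definition Const :: "'p::prime_card mod_ring \<Rightarrow> 'p mpoly" where
  "Const c = Poly_Mapping.single 0 c"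

definition X :: "nat \<Rightarrow> 'p::prime_card mpoly" where
  "X i = Poly_Mapping.single (Poly_Mapping.single i 1) 1"

definition poly_alg :: "nat \<Rightarrow> 'p::prime_card mpoly set" where
  "poly_alg n = {f. \<forall>m\<in>Poly_Mapping.keys f. Poly_Mapping.keys m \<subseteq> {1..n}}"

text \<open>Matrix indices start at 0 in the library, so the entry in row \<open>i\<close> and column \<open>j\<close>
  is the \<open>(i+1, j+1)\<close> entry in one-based numbering.\<close>

definition w :: "nat \<Rightarrow> 'p::prime_card mpoly" where
  "w n = det (mat n n (\<lambda>(i, j). X (j + 1) ^ (CARD('p) ^ i)))"


section \<open>The algebra of Steenrod powers\<close>

text \<open>The monoid algebra over words (lists under concatenation) in the natural numbers is the
  free associative algebra on symbols \<open>P^0, P^1, P^2, ...\<close>.\<close>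

datatype st_word = Word (letters: "nat list")

instantiation st_word :: monoid_add
begin

definition "0 = Word []"

definition "u + v = Word (letters u @ letters v)"

instance
  by standard (simp_all add: zero_st_word_def plus_st_word_def)

end

type_synonym 'p free_st = "st_word \<Rightarrow>\<^sub>0 'p mod_ring"

definition free_P :: "nat \<Rightarrow> 'p::prime_card free_st" where
  "free_P r = Poly_Mapping.single (Word [r]) 1"

text \<open>The two-sided ideal generated by \<open>P^0 - 1\<close> and the Adem relations
  \[ P^a P^b = \sum_{i=0}^{\lfloor a/p \rfloor} (-1)^{a+i} \binom{(p-1)(b-i)-1}{a-pi} P^{a+b-i} P^i
     \qquad (0 < a < pb). \]
  The subtractions on natural numbers below do not truncate: \<open>a < p * b\<close> and
  \<open>i \<le> a div p\<close> imply \<open>i < b\<close>.\<close>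

inductive_set adem_ideal :: "'p::prime_card free_st set" where
  unit: "free_P 0 - 1 \<in> adem_ideal"
| adem: "0 < a \<Longrightarrow> a < CARD('p) * b \<Longrightarrow>
    free_P a * free_P b
      - (\<Sum>i\<le>a div CARD('p).
          of_int ((-1) ^ (a + i))
          * of_nat (((CARD('p) - 1) * (b - i) - 1) choose (a - CARD('p) * i))
          * (free_P (a + b - i) * free_P i))
    \<in> (adem_ideal :: 'p free_st set)"
| zero: "0 \<in> adem_ideal"
| add: "f \<in> adem_ideal \<Longrightarrow> g \<in> adem_ideal \<Longrightarrow> f + g \<in> adem_ideal"
| mult_left: "f \<in> adem_ideal \<Longrightarrow> g * f \<in> adem_ideal"
| mult_right: "f \<in> adem_ideal \<Longrightarrow> f * g \<in> adem_ideal"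

lemma adem_ideal_uminus: "f \<in> adem_ideal \<Longrightarrow> - f \<in> adem_ideal"
  using adem_ideal.mult_left[of f "- 1"] by simp

definition adem_rel :: "'p::prime_card free_st \<Rightarrow> 'p free_st \<Rightarrow> bool" where
  "adem_rel f g \<longleftrightarrow> f - g \<in> adem_ideal"

lemma equivp_adem_rel: "equivp (adem_rel :: 'p::prime_card free_st \<Rightarrow> _)"
proof (rule equivpI)
  show "reflp (adem_rel :: 'p free_st \<Rightarrow> _)"
    by (simp add: reflp_def adem_rel_def adem_ideal.zero)
  show "symp (adem_rel :: 'p free_st \<Rightarrow> _)"
    unfolding symp_def adem_rel_def by (auto dest: adem_ideal_uminus)
  show "transp (adem_rel :: 'p free_st \<Rightarrow> _)"
    unfolding transp_def adem_rel_def
  proof (intro allI impI)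
    fix f g h :: "'p free_st"
    assume "f - g \<in> adem_ideal" "g - h \<in> adem_ideal"
    then have "(f - g) + (g - h) \<in> adem_ideal"
      by (rule adem_ideal.add)
    then show "f - h \<in> adem_ideal"
      by simp
  qed
qed

quotient_type 'p steenrod = "'p::prime_card free_st" / adem_rel
  by (rule equivp_adem_rel)

instantiation steenrod :: (prime_card) "{zero, one, plus, uminus, minus, times}"
begin

lift_definition zero_steenrod :: "'a steenrod" is 0 .

lift_definition one_steenrod :: "'a steenrod" is 1 .

lift_definition plus_steenrod :: "'a steenrod \<Rightarrow> 'a steenrod \<Rightarrow> 'a steenrod" is "(+)"
proof -
  fix f f' g g' :: "'a free_st"
  assume "adem_rel f f'" "adem_rel g g'"
  then have "(f - f') + (g - g') \<in> adem_ideal"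
    unfolding adem_rel_def by (rule adem_ideal.add)
  then show "adem_rel (f + g) (f' + g')"
    unfolding adem_rel_def by (simp only: add_diff_add)
qed

lift_definition uminus_steenrod :: "'a steenrod \<Rightarrow> 'a steenrod" is uminus
  unfolding adem_rel_def by (simp only: minus_diff_minus adem_ideal_uminus)

lift_definition minus_steenrod :: "'a steenrod \<Rightarrow> 'a steenrod \<Rightarrow> 'a steenrod" is "(-)"
proof -
  fix f f' g g' :: "'a free_st"
  assume "adem_rel f f'" "adem_rel g g'"
  then have "(f - f') + - (g - g') \<in> adem_ideal"
    unfolding adem_rel_def by (intro adem_ideal.add adem_ideal_uminus)
  then show "adem_rel (f - g) (f' - g')"
    unfolding adem_rel_def by (simp add: algebra_simps)
qed

lift_definition times_steenrod :: "'a steenrod \<Rightarrow> 'a steenrod \<Rightarrow> 'a steenrod" is "(*)"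
proof -
  fix f f' g g' :: "'a free_st"
  assume "adem_rel f f'" "adem_rel g g'"
  then have "(f - f') * g + f' * (g - g') \<in> adem_ideal"
    unfolding adem_rel_def
    by (intro adem_ideal.add adem_ideal.mult_left adem_ideal.mult_right)
  then show "adem_rel (f * g) (f' * g')"
    unfolding adem_rel_def by (simp add: algebra_simps)
qed

instance ..

end

lemma adem_rel_refl: "adem_rel f f"
  by (simp add: adem_rel_def adem_ideal.zero)

instance steenrod :: (prime_card) ring
proof
  fix a b c :: "'a steenrod"
  show "a + b + c = a + (b + c)"
    by transfer (simp only: add.assoc adem_rel_refl)
  show "a + b = b + a"
    by transfer (simp only: add.commute adem_rel_refl)
  show "0 + a = a"
    by transfer (simp only: add_0_left adem_rel_refl)
  show "- a + a = 0"
    by transfer (simp only: left_minus adem_rel_refl)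
  show "a - b = a + - b"
    by transfer (simp only: diff_conv_add_uminus adem_rel_refl)
  show "a * b * c = a * (b * c)"
    by transfer (simp only: mult.assoc adem_rel_refl)
  show "(a + b) * c = a * c + b * c"
    by transfer (simp only: distrib_right adem_rel_refl)
  show "a * (b + c) = a * b + a * c"
    by transfer (simp only: distrib_left adem_rel_refl)
qed

instance steenrod :: (prime_card) monoid_mult
proof
  fix a :: "'a steenrod"
  show "1 * a = a"
    by transfer (simp only: mult_1_left adem_rel_refl)
  show "a * 1 = a"
    by transfer (simp only: mult_1_right adem_rel_refl)
qed

text \<open>The ring structure above does not carry scalars; they sit in the free algebra as
  multiples of the empty word.\<close>

definition scale_st :: "'p::prime_card mod_ring \<Rightarrow> 'p steenrod \<Rightarrow> 'p steenrod" where
  "scale_st c a = abs_steenrod (Poly_Mapping.single 0 c) * a"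

definition St :: "nat \<Rightarrow> 'p::prime_card steenrod" where
  "St r = abs_steenrod (free_P r)"


section \<open>The action on polynomials and the canonical anti-automorphism\<close>

locale steenrod_action =
  fixes n :: nat
    and act :: "'p::prime_card steenrod \<Rightarrow> 'p mpoly \<Rightarrow> 'p mpoly"
  assumes act_closed: "f \<in> poly_alg n \<Longrightarrow> act a f \<in> poly_alg n"
    and act_add: "f \<in> poly_alg n \<Longrightarrow> g \<in> poly_alg n \<Longrightarrow> act a (f + g) = act a f + act a g"
    and act_scale: "f \<in> poly_alg n \<Longrightarrow> act a (Const c * f) = Const c * act a f"
    and add_act: "f \<in> poly_alg n \<Longrightarrow> act (a + b) f = act a f + act b f"
    and scale_act: "f \<in> poly_alg n \<Longrightarrow> act (scale_st c a) f = Const c * act a f"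
    and one_act: "f \<in> poly_alg n \<Longrightarrow> act 1 f = f"
    and mult_act: "f \<in> poly_alg n \<Longrightarrow> act (a * b) f = act a (act b f)"
    and P1_X: "i \<in> {1..n} \<Longrightarrow> act (St 1) (X i) = X i ^ CARD('p)"
    and P_X: "i \<in> {1..n} \<Longrightarrow> r > 1 \<Longrightarrow> act (St r) (X i) = 0"
    and P_one: "r > 0 \<Longrightarrow> act (St r) 1 = 0"
    and cartan: "f \<in> poly_alg n \<Longrightarrow> g \<in> poly_alg n \<Longrightarrow>
      act (St r) (f * g) = (\<Sum>s\<le>r. act (St s) f * act (St (r - s)) g)"

locale canonical_antiautomorphism =
  fixes \<chi> :: "'p::prime_card steenrod \<Rightarrow> 'p steenrod"
  assumes chi_bij: "bij \<chi>"
    and chi_add: "\<chi> (a + b) = \<chi> a + \<chi> b"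
    and chi_scale: "\<chi> (scale_st c a) = scale_st c (\<chi> a)"
    and chi_mult: "\<chi> (a * b) = \<chi> b * \<chi> a"
    and chi_one: "\<chi> 1 = 1"
    and chi_P: "r \<ge> 1 \<Longrightarrow> (\<Sum>i\<le>r. St i * \<chi> (St (r - i))) = 0"

end

theory Submission
  imports Defs "HOL-Computational_Algebra.Formal_Laurent_Series"
begin

text \<open>Give \<open>P\<^sup>r\<close> the sign \<open>(-1)\<^sup>r\<close> and collect these operations in \<open>f \<mapsto> \<Sum>\<^sub>r (-1)\<^sup>r P\<^sup>r(f) t\<^sup>r\<close>. By
  the Cartan formula this is a ring homomorphism, namely the substitution \<open>x \<mapsto> x - x\<^sup>p t\<close> for every
  variable \<open>x\<close>; the sequence is a Hasse-Schmidt derivation. The recursion that determines \<open>\<chi>\<close>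
  says that the signed operations \<open>(-1)\<^sup>r \<chi>(P\<^sup>r)\<close> form the inverse substitution. Write
  \<open>[k]\<close> for \<open>1 + p + \<dots> + p\<^sup>k\<^sup>-\<^sup>1\<close>. Since \<open>[k] + p\<^sup>k = [k+1]\<close>, the substitution sends the series
  \<open>y(x) = \<Sum>\<^sub>k x^(p^k) t^[k]\<close> to a telescoping sum with value \<open>x\<close>, so the inverse substitution is
  \<open>x \<mapsto> y(x)\<close> (\<open>ext_frobenius_series\<close>, \<open>act_conjugate_monomial\<close>). As \<open>p\<^sub>n - n\<close> is even, the left
  side of the theorem is therefore the coefficient of \<open>t^(p\<^sub>n - n)\<close> in
  \<open>(y(x\<^sub>1) \<cdots> y(x\<^sub>n))\<^sup>p\<^sup>-\<^sup>1\<close>.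

  Put \<open>t = s\<^sup>p\<^sup>-\<^sup>1\<close>. Then \<open>s y(x) = \<Sum>\<^sub>k x^(p^k) s^(p^k)\<close> is an additive series, that is, one
  whose exponents are powers of \<open>p\<close>, and the coefficient in question becomes that of \<open>s^(p^n - 1)\<close> in a
  product of \<open>(p-1)\<close>-st powers of \<open>n\<close> additive series. For arbitrary additive series
  \<open>L\<^sub>i\<close> over an integral domain of characteristic \<open>p\<close>, this coefficient is the \<open>(p-1)\<close>-st power of
  the determinant of the coefficients \<open>L\<^sub>i[s^(p^k)]\<close>, \<open>k < n\<close> (\<open>coeff_eq_det_power_if_additive\<close>).
  For the series \<open>s y(x\<^sub>i)\<close> the matrix is the transpose of the one that defines \<open>w n\<close>.

  The determinant formula is proved by Gaussian elimination. The two sides change in the same way under row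
  operations: replacing \<open>L\<^sub>j\<close> by \<open>L\<^sub>j + b L\<^sub>l\<close> changes the product by multiples of the additive series
  \<open>L\<^sub>l\<^sup>p\<close>, which leaves products of too few additive series to reach an exponent with digit sum
  \<open>n (p-1)\<close>. Once only one series has a linear term, the others are series in \<open>s\<^sup>p\<close>, and comparing
  exponents modulo \<open>p\<close> reduces the formula to \<open>n - 1\<close> series.\<close>

unbundle fps_syntax
\<comment> \<open>The same infix denotes vector entries; below it only denotes coefficients of power series.\<close>
no_notation Matrix.vec_index (infixl "$" 100)

section \<open>Digit sums\<close>

text \<open>The guard on the base only serves termination: bases 0 and 1 have no digits.\<close>

fun digit_sum :: "nat \<Rightarrow> nat \<Rightarrow> nat" where
  "digit_sum b m = (if b < 2 \<or> m = 0 then 0 else m mod b + digit_sum b (m div b))"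

declare digit_sum.simps [simp del]

lemma digit_sum_rec: "b \<ge> 2 \<Longrightarrow> digit_sum b m = m mod b + digit_sum b (m div b)"
  by (subst digit_sum.simps) (auto simp: digit_sum.simps[of b 0])

lemma digit_sum_0 [simp]: "digit_sum b 0 = 0"
  by (simp add: digit_sum.simps)

lemma digit_sum_Suc_le:
  assumes "b \<ge> 2"
  shows "digit_sum b (Suc m) \<le> Suc (digit_sum b m)"
proof (induction m rule: less_induct)
  case (less m)
  show ?case
  proof (cases "Suc (m mod b) = b")
    case False
    then show ?thesis
      using digit_sum_rec[OF assms, of m] digit_sum_rec[OF assms, of "Suc m"]
      by (simp add: mod_Suc div_Suc)
  next
    case True
    then have "m > 0" using assms by (cases m) auto
    then have "m div b < m" using assms by simp
    from less.IH[OF this] True show ?thesis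
      using digit_sum_rec[OF assms, of m] digit_sum_rec[OF assms, of "Suc m"]
      by (simp add: mod_Suc div_Suc)
  qed
qed

text \<open>Every carry in the addition replaces \<open>b\<close> in the digit sum by 1.\<close>

lemma digit_sum_add_le:
  assumes b: "b \<ge> 2"
  shows "digit_sum b (l + m) \<le> digit_sum b l + digit_sum b m"
proof (induction l arbitrary: m rule: less_induct)
  case (less l)
  show ?case
  proof (cases "l = 0")
    case False
    then have lt: "l div b < l" using b by simp
    let ?c = "l mod b + m mod b"
    have "?c < 2 * b"
      using mod_less_divisor[of b l] mod_less_divisor[of b m] b by linarith
    then have c: "?c div b \<le> 1" using b by (simp add: less_mult_imp_div_less less_Suc_eq_le[symmetric])
    have "digit_sum b (l + m) = ?c mod b + digit_sum b (l div b + m div b + ?c div b)"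
      by (metis digit_sum_rec[OF b] mod_add_eq div_add1_eq)
    also have "\<dots> \<le> ?c mod b + digit_sum b (l div b + m div b) + ?c div b"
    proof (cases "?c div b = 0")
      case False
      with c have "?c div b = 1" by linarith
      with digit_sum_Suc_le[OF b, of "l div b + m div b"] show ?thesis by simp
    qed simp
    also have "\<dots> \<le> ?c + digit_sum b (l div b + m div b)"
    proof -
      have "?c mod b + ?c div b \<le> ?c mod b + ?c div b * b"
        using b by (cases b) auto
      then show ?thesis by simp
    qed
    also have "\<dots> \<le> ?c + digit_sum b (l div b) + digit_sum b (m div b)"
      using less.IH[OF lt, of "m div b"] by simp
    also have "\<dots> = digit_sum b l + digit_sum b m"
      using digit_sum_rec[OF b, of l] digit_sum_rec[OF b, of m] by simp
    finally show ?thesis .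
  qed simp
qed

lemma power_Suc_minus_1_div_mod:
  fixes b :: nat
  assumes "b \<ge> 1"
  shows "(b ^ Suc n - 1) div b = b ^ n - 1" and "(b ^ Suc n - 1) mod b = b - 1"
proof -
  have "b ^ n \<ge> 1" using assms by simp
  then obtain m where "b ^ n = Suc m" by (cases "b ^ n") auto
  moreover obtain c where "b = Suc c" using assms by (cases b) auto
  ultimately have eq: "b ^ Suc n - 1 = (b ^ n - 1) * b + (b - 1)" by simp
  show "(b ^ Suc n - 1) div b = b ^ n - 1" and "(b ^ Suc n - 1) mod b = b - 1"
    unfolding eq using assms
    by (simp_all only: div_mult_self3 mod_mult_self3) simp_all
qed

lemma digit_sum_power_minus_1:
  assumes "b \<ge> 2"
  shows "digit_sum b (b ^ n - 1) = n * (b - 1)"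
proof (induction n)
  case (Suc n)
  have "b \<ge> 1" using assms by simp
  then show ?case
    using Suc digit_sum_rec[OF assms, of "b ^ Suc n - 1"]
    by (simp only: power_Suc_minus_1_div_mod) simp
qed simp

lemma digit_sum_power: "b \<ge> 2 \<Longrightarrow> digit_sum b (b ^ k) = 1"
  by (induction k) (subst digit_sum_rec; simp)+

section \<open>Additive power series and digit weights\<close>

lemma fps_const_prod: "fps_const (prod f I) = (\<Prod>i\<in>I. fps_const (f i))"
  by (induction I rule: infinite_finite_induct) (auto simp flip: fps_const_mult)

text \<open>Raising to the power \<open>p\<close> is additive in characteristic \<open>p\<close>, so it acts termwise on polynomials; the
  coefficient at \<open>e\<close> only sees the terms of degree at most \<open>e\<close>.\<close>

lemma fps_nth_power_CHAR:
  fixes f :: "'a::comm_ring_1 fps"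
  assumes p: "prime CHAR('a)"
  shows "(f ^ CHAR('a)) $ e = (if CHAR('a) dvd e then (f $ (e div CHAR('a))) ^ CHAR('a) else 0)"
proof -
  let ?p = "CHAR('a)"
  have pos: "?p > 0" using p by (rule prime_gt_0_nat)
  have lt: "e < Suc e * ?p" using pos by (cases ?p) auto
  let ?g = "\<Sum>i\<le>e. fps_const (f $ i) * fps_X ^ i"
  have f: "f = ?g + fps_X ^ Suc e * fps_shift (Suc e) f"
  proof (rule fps_ext)
    fix m
    have "?g $ m = (\<Sum>i\<le>e. f $ i * (if m = i then 1 else 0))"
      by (simp add: fps_sum_nth fps_X_power_nth)
    also have "\<dots> = (\<Sum>i\<le>e. if m = i then f $ i else 0)"
      by (rule sum.cong) auto
    also have "\<dots> = (if m \<le> e then f $ m else 0)"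
      by simp
    finally have "?g $ m = (if m \<le> e then f $ m else 0)" .
    then show "f $ m = (?g + fps_X ^ Suc e * fps_shift (Suc e) f) $ m"
      by (auto simp only: fps_add_nth fps_X_power_mult_nth fps_shift_nth) auto
  qed
  have "f ^ ?p = ?g ^ ?p + (fps_X ^ Suc e * fps_shift (Suc e) f) ^ ?p"
    by (subst f, rule freshmans_dream) (simp_all add: p)
  also have "?g ^ ?p = (\<Sum>i\<le>e. (fps_const (f $ i) * fps_X ^ i) ^ ?p)"
    by (rule freshmans_dream_sum) (simp_all add: p)
  also have "\<dots> = (\<Sum>i\<le>e. fps_const ((f $ i) ^ ?p) * fps_X ^ (i * ?p))"
    by (simp add: power_mult_distrib power_mult fps_const_power)
  also have "(fps_X ^ Suc e * fps_shift (Suc e) f) ^ ?p = fps_X ^ (Suc e * ?p) * fps_shift (Suc e) f ^ ?p"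
    by (simp only: power_mult_distrib power_mult)
  finally have "(f ^ ?p) $ e = (\<Sum>i\<le>e. (f $ i) ^ ?p * (if e = i * ?p then 1 else 0))
      + (if e < Suc e * ?p then 0 else (fps_shift (Suc e) f ^ ?p) $ (e - Suc e * ?p))"
    by (simp add: fps_sum_nth fps_X_power_mult_nth del: mult_Suc)
  also have "(\<Sum>i\<le>e. (f $ i) ^ ?p * (if e = i * ?p then 1 else 0)) =
      (\<Sum>i\<in>(if ?p dvd e then {e div ?p} else {}). (f $ i) ^ ?p * (if e = i * ?p then 1 else 0))"
    using pos by (intro sum.mono_neutral_right) (auto simp: div_le_dividend)
  finally show ?thesis using lt by auto
qed

text \<open>Apart from the finiteness of the support, these are the linearized polynomials, the additive functions in
  characteristic \<open>p\<close>.\<close>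

definition additive_fps :: "'a::semiring_1 fps \<Rightarrow> bool" where
  "additive_fps f \<longleftrightarrow> (\<forall>e. f $ e \<noteq> 0 \<longrightarrow> (\<exists>k. e = CHAR('a) ^ k))"

text \<open>A product of \<open>m\<close> additive series has its support in the sums of \<open>m\<close> powers of \<open>p\<close>, whose digit sums are
  at most \<open>m\<close>. This filtration by digit sum is compatible with products and detects when there are too few
  factors to reach a given exponent.\<close>

definition weight_le :: "nat \<Rightarrow> 'a::semiring_1 fps \<Rightarrow> bool" where
  "weight_le m f \<longleftrightarrow> (\<forall>e. f $ e \<noteq> 0 \<longrightarrow> digit_sum CHAR('a) e \<le> m)"

lemma weight_le_0 [simp]: "weight_le m 0"
  by (simp add: weight_le_def)

lemma weight_le_add: "weight_le m f \<Longrightarrow> weight_le m g \<Longrightarrow> weight_le m (f + g)"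
  unfolding weight_le_def by (metis add.right_neutral fps_add_nth)

lemma weight_le_sum: "(\<And>i. i \<in> A \<Longrightarrow> weight_le m (f i)) \<Longrightarrow> weight_le m (sum f A)"
  by (induction A rule: infinite_finite_induct) (auto intro: weight_le_add)

lemma weight_le_mult:
  fixes f g :: "'a::semiring_1 fps"
  assumes "weight_le m f" "weight_le l g" "CHAR('a) \<ge> 2"
  shows "weight_le (m + l) (f * g)"
  unfolding weight_le_def
proof (intro allI impI)
  fix e assume "(f * g) $ e \<noteq> 0"
  then obtain i where i: "i \<le> e" "f $ i \<noteq> 0" "g $ (e - i) \<noteq> 0"
    unfolding fps_mult_nth by (metis (no_types, lifting) atLeastAtMost_iff mult_not_zero sum.neutral)
  then have "digit_sum CHAR('a) i + digit_sum CHAR('a) (e - i) \<le> m + l"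
    using assms(1,2) unfolding weight_le_def by (intro add_mono) auto
  then show "digit_sum CHAR('a) e \<le> m + l"
    using digit_sum_add_le[OF assms(3), of i "e - i"] i(1) by simp
qed

lemma weight_le_1: "weight_le 0 1"
  by (auto simp: weight_le_def)

lemma weight_le_power:
  fixes f :: "'a::semiring_1 fps"
  assumes "weight_le 1 f" "CHAR('a) \<ge> 2"
  shows "weight_le m (f ^ m)"
proof (induction m)
  case (Suc m)
  from weight_le_mult[OF assms(1) Suc assms(2)] show ?case by simp
qed (simp add: weight_le_1)

lemma weight_le_const_mult:
  fixes f :: "'a::semiring_1 fps"
  shows "weight_le m f \<Longrightarrow> weight_le m (fps_const c * f)"
  unfolding weight_le_def by (metis fps_mult_left_const_nth mult_not_zero)

lemma weight_le_prod:
  fixes f :: "'b \<Rightarrow> 'a::comm_semiring_1 fps"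
  assumes "finite A" "\<And>i. i \<in> A \<Longrightarrow> weight_le m (f i)" "CHAR('a) \<ge> 2"
  shows "weight_le (card A * m) (prod f A)"
  using assms(1,2)
proof (induction A)
  case (insert a A)
  have "weight_le (m + card A * m) (f a * prod f A)"
    using insert by (intro weight_le_mult assms(3)) auto
  then show ?case using insert by simp
qed (simp add: weight_le_1)

lemma additive_imp_weight_le_1:
  fixes f :: "'a::semiring_1 fps"
  assumes "additive_fps f" "CHAR('a) \<ge> 2"
  shows "weight_le 1 f"
  unfolding weight_le_def
proof (intro allI impI)
  fix e assume "f $ e \<noteq> 0"
  then obtain k where "e = CHAR('a) ^ k" using assms(1) unfolding additive_fps_def by blast
  then show "digit_sum CHAR('a) e \<le> 1" by (simp add: digit_sum_power assms(2))
qed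

text \<open>A \<open>p\<close>-th power of an additive series has weight 1 instead of \<open>p\<close>; this is where weight is lost in
  \<open>row_operation_weight\<close>.\<close>

lemma additive_power_CHAR:
  fixes f :: "'a::comm_ring_1 fps"
  assumes "additive_fps f" and p: "prime CHAR('a)"
  shows "additive_fps (f ^ CHAR('a))"
  unfolding additive_fps_def
proof (intro allI impI)
  fix e assume "(f ^ CHAR('a)) $ e \<noteq> 0"
  then have d: "CHAR('a) dvd e" and "(f $ (e div CHAR('a))) ^ CHAR('a) \<noteq> 0"
    by (auto simp: fps_nth_power_CHAR[OF p] split: if_splits)
  then have "f $ (e div CHAR('a)) \<noteq> 0" using prime_gt_0_nat[OF p] by (auto simp: zero_power)
  then obtain k where "e div CHAR('a) = CHAR('a) ^ k" using assms(1) unfolding additive_fps_def by blast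
  with d have "e = CHAR('a) ^ Suc k" by (metis dvd_mult_div_cancel power_Suc)
  then show "\<exists>k. e = CHAR('a) ^ k" ..
qed

lemma additive_diff:
  fixes f g :: "'a::ring_1 fps"
  shows "additive_fps f \<Longrightarrow> additive_fps g \<Longrightarrow> additive_fps (f - g)"
  unfolding additive_fps_def by (metis diff_zero fps_sub_nth)

lemma additive_const_mult:
  "additive_fps f \<Longrightarrow> additive_fps (fps_const c * f)"
  unfolding additive_fps_def by (metis fps_mult_left_const_nth mult_zero_right)

text \<open>All \<open>n\<close> digits of \<open>p^n - 1\<close> are \<open>p - 1\<close>, so its digit sum is \<open>n (p - 1)\<close>.\<close>

lemma weight_le_imp_coeff_eq_0:
  fixes f :: "'a::semiring_1 fps"
  assumes "weight_le m f" "m < n * (CHAR('a) - 1)" "CHAR('a) \<ge> 2"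
  shows "f $ (CHAR('a) ^ n - 1) = 0"
  using assms unfolding weight_le_def by (metis digit_sum_power_minus_1 leD)

text \<open>The difference \<open>(f - b g)\<^sup>p\<^sup>-\<^sup>1 - f\<^sup>p\<^sup>-\<^sup>1\<close> is divisible by \<open>g\<close>. Together with the factor
  \<open>g\<^sup>p\<^sup>-\<^sup>1\<close> this gives the additive series \<open>g\<^sup>p\<close>, times a cofactor of degree \<open>p - 2\<close> in \<open>f\<close> and
  \<open>g\<close>. The weight is therefore at most \<open>p - 1\<close>, whereas each of the two products alone can have
  weight \<open>2 (p - 1)\<close>.\<close>

lemma row_operation_weight:
  fixes f g :: "'a::comm_ring_1 fps"
  assumes f: "additive_fps f" and g: "additive_fps g" and p: "prime CHAR('a)"
  shows "weight_le (CHAR('a) - 1) ((f - fps_const b * g) ^ (CHAR('a) - 1) * g ^ (CHAR('a) - 1)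
            - f ^ (CHAR('a) - 1) * g ^ (CHAR('a) - 1))"
proof -
  let ?p = "CHAR('a)"
  let ?f' = "f - fps_const b * g"
  have p2: "?p \<ge> 2" using p by (rule prime_ge_2_nat)
  then obtain q where q: "?p = Suc (Suc q)" by (metis add_2_eq_Suc le_Suc_ex)
  define h where "h = (\<Sum>i<Suc q. ?f' ^ i * f ^ (q - i))"
  have h: "?f' ^ Suc q - f ^ Suc q = fps_const (- b) * (g * h)"
  proof -
    have "?f' ^ Suc q - f ^ Suc q = (?f' - f) * h"
      unfolding h_def using power_diff_sumr2[of ?f' "Suc q" f] by (simp add: mult.commute)
    also have "?f' - f = fps_const (- b) * g"
      by (simp add: fps_eq_iff)
    finally show ?thesis by (simp add: mult.assoc)
  qed
  have wf: "weight_le 1 f" "weight_le 1 ?f'"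
    by (rule additive_imp_weight_le_1[OF _ p2], intro f g additive_diff additive_const_mult)+
  have wh: "weight_le q h"
    unfolding h_def
  proof (rule weight_le_sum)
    fix i assume "i \<in> {..<Suc q}"
    then have "i + (q - i) = q" by simp
    with weight_le_mult[OF weight_le_power[OF wf(2) p2, of i] weight_le_power[OF wf(1) p2, of "q - i"] p2]
    show "weight_le q (?f' ^ i * f ^ (q - i))" by simp
  qed
  have "weight_le (1 + q) (g ^ ?p * h)"
    using weight_le_mult[OF additive_imp_weight_le_1[OF additive_power_CHAR[OF g p] p2] wh p2] .
  then have "weight_le (1 + q) (fps_const (- b) * (g ^ ?p * h))" by (rule weight_le_const_mult)
  also have "fps_const (- b) * (g ^ ?p * h) = (?f' ^ Suc q - f ^ Suc q) * g ^ Suc q"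
    unfolding h q by (simp add: mult_ac)
  finally show ?thesis unfolding q by (simp add: left_diff_distrib)
qed

section \<open>A determinant as a coefficient of a product of additive series\<close>

definition coeff_eq_det_power :: "nat \<Rightarrow> (nat \<Rightarrow> 'a::comm_ring_1 fps) \<Rightarrow> bool" where
  "coeff_eq_det_power n L \<longleftrightarrow>
     (\<Prod>i<n. L i ^ (CHAR('a) - 1)) $ (CHAR('a) ^ n - 1)
       = det (mat n n (\<lambda>(i, k). L i $ (CHAR('a) ^ k))) ^ (CHAR('a) - 1)"

lemma det_row_operation:
  fixes z :: "nat \<Rightarrow> nat \<Rightarrow> 'a::comm_ring_1"
  assumes "j < n" "l < n" "j \<noteq> l"
  shows "det (mat n n (\<lambda>(i, k). if i = j then a * z j k - b * z l k else z i k))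
       = a * det (mat n n (\<lambda>(i, k). z i k))"
proof -
  let ?A = "mat n n (\<lambda>(i, k). z i k)"
  have "mat n n (\<lambda>(i, k). if i = j then a * z j k - b * z l k else z i k)
      = addrow (- b) j l (multrow j a ?A)"
    by (rule eq_matI) (use assms in auto)
  also have "det \<dots> = det (multrow j a ?A)"
    by (rule det_addrow[of _ n]) (use assms in auto)
  also have "\<dots> = a * det ?A"
    by (rule det_multrow[of _ n]) (use assms in auto)
  finally show ?thesis .
qed

text \<open>The step of a fraction-free elimination: both sides of the identity for the changed rows are
  \<open>a\<^sup>p\<^sup>-\<^sup>1\<close> times the sides for the original rows. For the coefficient this is because the error term
  of \<open>row_operation_weight\<close>, multiplied by the remaining \<open>n - 2\<close> factors, has too small a weight to
  contribute.\<close>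

lemma coeff_eq_det_power_row_operation:
  fixes L :: "nat \<Rightarrow> 'a::idom fps"
  assumes p: "prime CHAR('a)" and L: "\<And>i. i < n \<Longrightarrow> additive_fps (L i)"
    and jl: "j < n" "l < n" "j \<noteq> l" and a: "a \<noteq> 0"
    and *: "coeff_eq_det_power n (L(j := fps_const a * L j - fps_const b * L l))"
  shows "coeff_eq_det_power n L"
proof -
  let ?q = "CHAR('a) - 1" and ?N = "CHAR('a) ^ n - 1"
  have p2: "CHAR('a) \<ge> 2" using p by (rule prime_ge_2_nat)
  define L' where "L' = L(j := fps_const a * L j - fps_const b * L l)"
  define I where "I = {..<n} - {j, l}"
  define R where "R = (\<Prod>i\<in>I. L i ^ ?q)"
  have n: "{..<n} = insert j (insert l I)" and nI: "j \<notin> insert l I" "l \<notin> I" "finite I"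
    using jl by (auto simp: I_def)
  have cardI: "card I = n - 2"
    using jl unfolding I_def by (subst card_Diff_subset) auto
  \<comment> \<open>\<open>M\<close> stands for \<open>L\<close> and for \<open>L'\<close>, which agree on the rows in \<open>I\<close>.\<close>
  have split: "(\<Prod>i<n. M i ^ ?q) = (M j ^ ?q * M l ^ ?q) * R"
    if "\<And>i. i \<in> I \<Longrightarrow> M i = L i" for M
    unfolding n R_def using nI that by (simp add: mult.assoc cong: prod.cong)
  have "weight_le ((n - 2) * ?q) R"
    unfolding R_def cardI[symmetric]
    by (rule weight_le_prod) (auto simp: I_def p2 nI intro!: weight_le_power additive_imp_weight_le_1 L)
  moreover have "weight_le ?q (L' j ^ ?q * L' l ^ ?q - (fps_const a * L j) ^ ?q * L l ^ ?q)"
    using row_operation_weight[of "fps_const a * L j" "L l" b] jl p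
    by (auto simp: L'_def intro: additive_const_mult L)
  ultimately have "weight_le (?q + (n - 2) * ?q)
      ((L' j ^ ?q * L' l ^ ?q - (fps_const a * L j) ^ ?q * L l ^ ?q) * R)"
    by (intro weight_le_mult p2)
  moreover have "?q + (n - 2) * ?q < n * ?q"
  proof -
    have "n = Suc (Suc (n - 2))" using jl by linarith
    then have "n * ?q = ?q + (?q + (n - 2) * ?q)" by (metis mult_Suc)
    with p2 show ?thesis by linarith
  qed
  ultimately have "((L' j ^ ?q * L' l ^ ?q - (fps_const a * L j) ^ ?q * L l ^ ?q) * R) $ ?N = 0"
    using weight_le_imp_coeff_eq_0 p2 by blast
  then have "((L' j ^ ?q * L' l ^ ?q) * R) $ ?N = (((fps_const a * L j) ^ ?q * L l ^ ?q) * R) $ ?N"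
    by (simp add: left_diff_distrib)
  also have "((fps_const a * L j) ^ ?q * L l ^ ?q) * R = fps_const (a ^ ?q) * ((L j ^ ?q * L l ^ ?q) * R)"
    by (simp add: power_mult_distrib mult_ac fps_const_power)
  finally have coeff: "(\<Prod>i<n. L' i ^ ?q) $ ?N = a ^ ?q * (\<Prod>i<n. L i ^ ?q) $ ?N"
    using split[of L'] split[of L] by (auto simp: L'_def I_def)
  have "mat n n (\<lambda>(i, k). L' i $ (CHAR('a) ^ k)) =
      mat n n (\<lambda>(i, k). if i = j then a * L j $ (CHAR('a) ^ k) - b * L l $ (CHAR('a) ^ k) else L i $ (CHAR('a) ^ k))"
    by (rule eq_matI) (auto simp: L'_def)
  then have "det (mat n n (\<lambda>(i, k). L' i $ (CHAR('a) ^ k))) = a * det (mat n n (\<lambda>(i, k). L i $ (CHAR('a) ^ k)))"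
    using det_row_operation[OF jl, of a "\<lambda>i k. L i $ (CHAR('a) ^ k)" b] by simp
  with * coeff a show ?thesis
    unfolding coeff_eq_det_power_def L'_def[symmetric] by (simp add: power_mult_distrib)
qed

lemma coeff_eq_det_power_eliminate:
  fixes L :: "nat \<Rightarrow> 'a::idom fps"
  assumes p: "prime CHAR('a)" and L: "\<And>i. i < n \<Longrightarrow> additive_fps (L i)"
    and l: "l < n" and a: "a \<noteq> 0" and I: "finite I" "I \<subseteq> {..<n} - {l}"
    and *: "coeff_eq_det_power n (\<lambda>i. if i \<in> I then fps_const a * L i - fps_const (b i) * L l else L i)"
  shows "coeff_eq_det_power n L"
  using I *
proof (induction I)
  case (insert j I)
  let ?M = "\<lambda>i. if i \<in> I then fps_const a * L i - fps_const (b i) * L l else L i"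
  have "coeff_eq_det_power n (?M(j := fps_const a * ?M j - fps_const (b j) * ?M l))"
  proof -
    have "?M(j := fps_const a * ?M j - fps_const (b j) * ?M l)
        = (\<lambda>i. if i \<in> insert j I then fps_const a * L i - fps_const (b i) * L l else L i)"
      using insert.hyps insert.prems(1) by (auto simp: fun_eq_iff)
    then show ?thesis using insert.prems(2) by simp
  qed
  then have "coeff_eq_det_power n ?M"
    by (rule coeff_eq_det_power_row_operation[OF p, rotated -1])
       (use insert.prems(1) l a in \<open>auto intro!: additive_diff additive_const_mult L\<close>)
  with insert.IH insert.prems(1) show ?case by simp
qed simp

text \<open>Expand the power of the binomial: its \<open>i\<close>-th term is \<open>X\<^sup>i\<close> times a series in \<open>X\<^sup>m\<close>, and only
  \<open>i = m - 1\<close> has the right residue modulo \<open>m\<close>.\<close>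

lemma coeff_linear_power_times_sparse:
  fixes K G :: "'a::idom fps"
  assumes m: "m \<ge> 1"
  shows "((fps_const a * fps_X + (K oo fps_X ^ m)) ^ (m - 1) * (G oo fps_X ^ m)) $ (m * e + (m - 1))
      = a ^ (m - 1) * G $ e"
proof -
  let ?q = "m - 1"
  have X0: "(fps_X ^ m :: 'a fps) $ 0 = 0" using m by simp
  have expand: "(fps_const a * fps_X + (K oo fps_X ^ m)) ^ ?q * (G oo fps_X ^ m) =
     (\<Sum>i\<le>?q. fps_const (of_nat (?q choose i) * a ^ i) * (fps_X ^ i * ((K ^ (?q - i) * G) oo fps_X ^ m)))"
    unfolding binomial_ring sum_distrib_right
    by (rule sum.cong[OF refl])
       (simp add: power_mult_distrib fps_compose_mult_distrib[OF X0] fps_compose_power[OF X0]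
          fps_const_power mult_ac flip: fps_of_nat fps_const_mult)
  have coeff: "(fps_X ^ i * (H oo fps_X ^ m)) $ (m * e + ?q) = (if i = ?q then H $ e else 0)"
    if "i \<le> ?q" for i and H :: "'a fps"
  proof -
    have "m * e + ?q - i = m * e + (?q - i)" using that by simp
    moreover have "m dvd m * e + (?q - i) \<longleftrightarrow> i = ?q"
    proof
      assume "m dvd m * e + (?q - i)"
      then have "m dvd ?q - i" by (simp add: dvd_add_right_iff)
      moreover have "?q - i < m" using m by linarith
      ultimately have "?q - i = 0" by (meson dvd_imp_le leD not_gr_zero)
      with that show "i = ?q" by simp
    qed simp
    ultimately show ?thesis
      using that m by (auto simp: fps_X_power_mult_nth fps_nth_compose_X_power)
  qed
  have "((fps_const a * fps_X + (K oo fps_X ^ m)) ^ ?q * (G oo fps_X ^ m)) $ (m * e + ?q)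
      = (\<Sum>i\<le>?q. if i = ?q then a ^ ?q * G $ e else 0)"
    unfolding expand fps_sum_nth fps_mult_left_const_nth
    by (rule sum.cong[OF refl]) (simp only: coeff atMost_iff split: if_splits, simp)
  then show ?thesis by simp
qed

text \<open>If all rows other than \<open>l\<close> have zero in column 0, then \<open>L\<^sub>i(s) = K\<^sub>i(s\<^sup>p)\<close> for these rows and
  \<open>L\<^sub>l(s) = a s + K\<^sub>l(s\<^sup>p)\<close> with additive \<open>K\<^sub>i\<close>. Modulo \<open>p\<close> the exponent \<open>p^(n+1) - 1\<close> is
  \<open>p - 1\<close>, so it is reached only through \<open>(a s)\<^sup>p\<^sup>-\<^sup>1\<close>. What remains is the coefficient for the
  rows \<open>K\<^sub>i\<close> at \<open>p^n - 1\<close>, which matches the minor in the Laplace expansion along column 0.\<close>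

lemma coeff_eq_det_power_single_pivot:
  fixes L :: "nat \<Rightarrow> 'a::idom fps"
  assumes p: "prime CHAR('a)" and odd: "odd CHAR('a)"
    and L: "\<And>i. i < Suc n \<Longrightarrow> additive_fps (L i)"
    and l: "l < Suc n" and zero: "\<And>i. i < Suc n \<Longrightarrow> i \<noteq> l \<Longrightarrow> L i $ 1 = 0"
    and IH: "\<And>M :: nat \<Rightarrow> 'a fps. (\<And>i. i < n \<Longrightarrow> additive_fps (M i)) \<Longrightarrow> coeff_eq_det_power n M"
  shows "coeff_eq_det_power (Suc n) L"
proof -
  let ?p = "CHAR('a)" and ?q = "CHAR('a) - 1"
  have p0: "?p > 0" and p1: "?p \<ge> 1" and p2: "?p \<ge> 2" using prime_ge_2_nat[OF p] by simp_all
  have X0: "(fps_X ^ ?p :: 'a fps) $ 0 = 0" using p0 by simp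
  \<comment> \<open>The numbering of the rows in the minor that omits row \<open>l\<close>.\<close>
  define skip where "skip i = (if i < l then i else Suc i)" for i
  define K where "K i = Abs_fps (\<lambda>e. if e = 0 then 0 else L i $ (?p * e))" for i
  have L_eq: "L i = fps_const (L i $ 1) * fps_X + (K i oo fps_X ^ ?p)" if i: "i < Suc n" for i
  proof (rule fps_ext)
    fix e
    show "L i $ e = (fps_const (L i $ 1) * fps_X + (K i oo fps_X ^ ?p)) $ e"
    proof (cases "?p dvd e")
      case True
      have "L i $ 0 = 0" using L[OF i] p0 unfolding additive_fps_def by fastforce
      moreover have "e \<noteq> 1" using True p2 by auto
      ultimately show ?thesis
        using True by (auto simp: K_def fps_nth_compose_X_power)
    next
      case False
      have "L i $ e = 0" if "e \<noteq> 1"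
      proof (rule ccontr)
        assume "L i $ e \<noteq> 0"
        then obtain k where "e = ?p ^ k" using L[OF i] unfolding additive_fps_def by blast
        with False \<open>e \<noteq> 1\<close> show False by (cases k) auto
      qed
      with False show ?thesis
        by (cases "e = 1") (auto simp: fps_nth_compose_X_power)
    qed
  qed
  have addK: "additive_fps (K i)" if i: "i < Suc n" for i
    unfolding additive_fps_def
  proof (intro allI impI)
    fix e assume "K i $ e \<noteq> 0"
    then have e: "e \<noteq> 0" "L i $ (?p * e) \<noteq> 0" by (auto simp: K_def split: if_splits)
    then obtain k where "?p * e = ?p ^ k" using L[OF i] unfolding additive_fps_def by blast
    with e p2 show "\<exists>k. e = ?p ^ k" by (cases k) auto
  qed
  have skip: "bij_betw skip {..<n} ({..<Suc n} - {l})"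
  proof (rule bij_betwI[where g = "\<lambda>i. if i < l then i else i - 1"])
  qed (use l in \<open>auto simp: skip_def split: if_splits\<close>)
  then have skip_range: "skip i < Suc n" "skip i \<noteq> l" if "i < n" for i
    using that by (auto simp: bij_betw_def)
  have "coeff_eq_det_power n (\<lambda>i. K (skip i))"
    by (rule IH) (intro addK skip_range)
  then have minor: "(\<Prod>i<n. K (skip i) ^ ?q) $ (?p ^ n - 1)
      = det (mat n n (\<lambda>(i, k). L (skip i) $ (?p ^ Suc k))) ^ ?q"
    unfolding coeff_eq_det_power_def K_def using p0 by simp

  have "(\<Prod>i<Suc n. L i ^ ?q) = L l ^ ?q * (\<Prod>i\<in>{..<Suc n} - {l}. L i ^ ?q)"
    using l by (intro prod.remove) auto
  also have "(\<Prod>i\<in>{..<Suc n} - {l}. L i ^ ?q) = (\<Prod>i<n. L (skip i) ^ ?q)"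
    by (rule prod.reindex_bij_betw[OF skip, symmetric])
  also have "\<dots> = (\<Prod>i<n. (K (skip i) ^ ?q) oo fps_X ^ ?p)"
  proof (rule prod.cong[OF refl])
    fix i assume "i \<in> {..<n}"
    then have "L (skip i) = K (skip i) oo fps_X ^ ?p"
      using L_eq[of "skip i"] zero[of "skip i"] skip_range[of i] by simp
    then show "L (skip i) ^ ?q = (K (skip i) ^ ?q) oo fps_X ^ ?p"
      by (simp add: fps_compose_power[OF X0])
  qed
  also have "\<dots> = (\<Prod>i<n. K (skip i) ^ ?q) oo fps_X ^ ?p"
    by (rule fps_compose_prod_distrib[OF X0, symmetric])
  also have "L l = fps_const (L l $ 1) * fps_X + (K l oo fps_X ^ ?p)"
    by (rule L_eq[OF l])
  finally have "(\<Prod>i<Suc n. L i ^ ?q) $ (?p * (?p ^ n - 1) + ?q)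
      = (L l $ 1) ^ ?q * (\<Prod>i<n. K (skip i) ^ ?q) $ (?p ^ n - 1)"
    by (simp only: coeff_linear_power_times_sparse[OF p1])
  also have "?p * (?p ^ n - 1) + ?q = ?p ^ Suc n - 1"
    using power_Suc_minus_1_div_mod[OF p1, of n] by (metis mult_div_mod_eq)
  finally have coeff: "(\<Prod>i<Suc n. L i ^ ?q) $ (?p ^ Suc n - 1)
      = (L l $ 1) ^ ?q * det (mat n n (\<lambda>(i, k). L (skip i) $ (?p ^ Suc k))) ^ ?q"
    by (simp only: minor)

  let ?A = "mat (Suc n) (Suc n) (\<lambda>(i, k). L i $ (?p ^ k))"
  have "det ?A = (\<Sum>i<Suc n. ?A $$ (i, 0) * cofactor ?A i 0)"
    by (rule laplace_expansion_column) auto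
  also have "\<dots> = (\<Sum>i<Suc n. if i = l then L l $ 1 * cofactor ?A l 0 else 0)"
    by (rule sum.cong) (auto simp: zero[simplified])
  also have "\<dots> = L l $ 1 * cofactor ?A l 0"
    using l by simp
  also have "mat_delete ?A l 0 = mat n n (\<lambda>(i, k). L (skip i) $ (?p ^ Suc k))"
    unfolding mat_delete_def by (rule eq_matI) (auto simp: skip_def)
  then have "cofactor ?A l 0 = (-1) ^ l * det (mat n n (\<lambda>(i, k). L (skip i) $ (?p ^ Suc k)))"
    by (simp add: cofactor_def)
  finally have "det ?A ^ ?q = (L l $ 1) ^ ?q * det (mat n n (\<lambda>(i, k). L (skip i) $ (?p ^ Suc k))) ^ ?q"
    using odd by (simp add: power_mult_distrib flip: power_mult)
  with coeff show ?thesis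
    unfolding coeff_eq_det_power_def by (simp only:)
qed

lemma coeff_eq_det_power_if_additive:
  fixes L :: "nat \<Rightarrow> 'a::idom fps"
  assumes p: "prime CHAR('a)" and odd: "odd CHAR('a)"
    and L: "\<And>i. i < n \<Longrightarrow> additive_fps (L i)"
  shows "coeff_eq_det_power n L"
  using L
proof (induction n arbitrary: L)
  case 0
  then show ?case by (simp add: coeff_eq_det_power_def)
next
  case (Suc n)
  show ?case
  proof (cases "\<forall>i<Suc n. L i $ 1 = 0")
    case True
    \<comment> \<open>Then every row can serve as the pivot row, as the pivot itself may vanish.\<close>
    show ?thesis
      by (rule coeff_eq_det_power_single_pivot[OF p odd, where l = 0]) (use True Suc in auto)
  next
    case False
    then obtain l where l: "l < Suc n" "L l $ 1 \<noteq> 0" by blast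
    let ?I = "{..<Suc n} - {l}"
    show ?thesis
    proof (rule coeff_eq_det_power_eliminate[OF p Suc.prems l, where I = ?I and b = "\<lambda>i. L i $ 1"])
      show "coeff_eq_det_power (Suc n)
         (\<lambda>i. if i \<in> ?I then fps_const (L l $ 1) * L i - fps_const (L i $ 1) * L l else L i)"
        by (rule coeff_eq_det_power_single_pivot[OF p odd _ l(1)])
           (use Suc.IH in \<open>auto intro!: additive_diff additive_const_mult Suc.prems[simplified] l(1)[simplified]\<close>)
    qed auto
  qed
qed

section \<open>Hasse-Schmidt derivations\<close>

text \<open>A Hasse-Schmidt derivation is a sequence of additive maps for which \<open>f \<mapsto> \<Sum>\<^sub>r D\<^sub>r(f) t\<^sup>r\<close> is a ring
  homomorphism that reduces to the identity modulo \<open>t\<close>. The carrier is explicit because the Steenrod operations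
  are only controlled on the polynomials in \<open>n\<close> of the variables.\<close>

locale hasse_schmidt =
  fixes A :: "'a::comm_ring_1 set" and D :: "nat \<Rightarrow> 'a \<Rightarrow> 'a"
  assumes zero_closed: "0 \<in> A" and one_closed: "1 \<in> A"
    and add_closed: "f \<in> A \<Longrightarrow> g \<in> A \<Longrightarrow> f + g \<in> A"
    and mult_closed: "f \<in> A \<Longrightarrow> g \<in> A \<Longrightarrow> f * g \<in> A"
    and D_add: "f \<in> A \<Longrightarrow> g \<in> A \<Longrightarrow> D r (f + g) = D r f + D r g"
    and D_0: "f \<in> A \<Longrightarrow> D 0 f = f"
    and D_one: "r > 0 \<Longrightarrow> D r 1 = 0"
    and D_mult: "f \<in> A \<Longrightarrow> g \<in> A \<Longrightarrow> D r (f * g) = (\<Sum>s\<le>r. D s f * D (r - s) g)"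
begin

lemma D_zero: "D r 0 = 0"
  using D_add[OF zero_closed zero_closed, of r] by simp

lemma sum_closed: "(\<And>i. i \<in> I \<Longrightarrow> f i \<in> A) \<Longrightarrow> sum f I \<in> A"
  by (induction I rule: infinite_finite_induct) (auto intro: zero_closed add_closed)

lemma power_closed: "f \<in> A \<Longrightarrow> f ^ m \<in> A"
  by (induction m) (auto intro: one_closed mult_closed)

lemma prod_closed: "(\<And>i. i \<in> I \<Longrightarrow> f i \<in> A) \<Longrightarrow> prod f I \<in> A"
  by (induction I rule: infinite_finite_induct) (auto intro: one_closed mult_closed)

lemma D_sum: "(\<And>i. i \<in> I \<Longrightarrow> f i \<in> A) \<Longrightarrow> D r (sum f I) = (\<Sum>i\<in>I. D r (f i))"
  by (induction I rule: infinite_finite_induct) (auto simp: D_zero D_add sum_closed)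

definition coeffs_in :: "'a fps \<Rightarrow> bool" where
  "coeffs_in F \<longleftrightarrow> (\<forall>e. F $ e \<in> A)"

text \<open>The \<open>t\<close>-linear extension of \<open>f \<mapsto> \<Sum>\<^sub>r D\<^sub>r(f) t\<^sup>r\<close> to power series in \<open>t\<close>.\<close>

definition ext :: "'a fps \<Rightarrow> 'a fps" where
  "ext F = Abs_fps (\<lambda>r. \<Sum>i\<le>r. D i (F $ (r - i)))"

lemma coeffs_in_const: "f \<in> A \<Longrightarrow> coeffs_in (fps_const f)"
  by (auto simp: coeffs_in_def zero_closed)

lemma coeffs_in_mult: "coeffs_in F \<Longrightarrow> coeffs_in G \<Longrightarrow> coeffs_in (F * G)"
  unfolding coeffs_in_def fps_mult_nth by (auto intro!: sum_closed mult_closed)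

lemma coeffs_in_1: "coeffs_in 1"
  using coeffs_in_const[OF one_closed] by simp

lemma coeffs_in_power: "coeffs_in F \<Longrightarrow> coeffs_in (F ^ m)"
  by (induction m) (auto intro: coeffs_in_1 coeffs_in_mult)

lemma coeffs_in_prod: "(\<And>i. i \<in> I \<Longrightarrow> coeffs_in (F i)) \<Longrightarrow> coeffs_in (prod F I)"
  by (induction I rule: infinite_finite_induct) (auto intro: coeffs_in_1 coeffs_in_mult)

lemma ext_const: "ext (fps_const f) = Abs_fps (\<lambda>r. D r f)"
proof (rule fps_ext)
  fix r
  have "ext (fps_const f) $ r = (\<Sum>i\<le>r. if i = r then D r f else 0)"
    unfolding ext_def fps_nth_Abs_fps by (rule sum.cong) (auto simp: D_zero)
  then show "ext (fps_const f) $ r = Abs_fps (\<lambda>r. D r f) $ r" by simp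
qed

lemma ext_1: "ext 1 = 1"
proof -
  have "ext (fps_const 1) = 1"
    unfolding ext_const by (rule fps_ext) (auto simp: D_one D_0 one_closed)
  then show ?thesis by simp
qed

text \<open>Both coefficients at \<open>r\<close> are the sum of \<open>D\<^sub>a(F\<^sub>j) D\<^sub>b(G\<^sub>k)\<close> over \<open>a + b + j + k = r\<close>.\<close>

lemma ext_mult:
  assumes F: "coeffs_in F" and G: "coeffs_in G"
  shows "ext (F * G) = ext F * ext G"
proof (rule fps_ext)
  fix r
  have FA: "F $ e \<in> A" and GA: "G $ e \<in> A" for e
    using F G unfolding coeffs_in_def by auto
  have "ext (F * G) $ r = (\<Sum>i\<le>r. D i (\<Sum>j\<le>r - i. F $ j * G $ (r - i - j)))"
    by (simp add: ext_def fps_mult_nth atLeast0AtMost)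
  also have "\<dots> = (\<Sum>i\<le>r. \<Sum>j\<le>r - i. \<Sum>a\<le>i. D a (F $ j) * D (i - a) (G $ (r - i - j)))"
    by (simp add: D_sum D_mult mult_closed FA GA)
  also have "\<dots> = (\<Sum>(i, j, a)\<in>(SIGMA i:{..r}. {..r - i} \<times> {..i}). D a (F $ j) * D (i - a) (G $ (r - i - j)))"
    by (simp add: sum.Sigma sum.cartesian_product)
  also have "\<dots> = (\<Sum>(u, a, b)\<in>(SIGMA u:{..r}. {..u} \<times> {..r - u}). D a (F $ (u - a)) * D b (G $ (r - u - b)))"
    by (rule sum.reindex_bij_witness[where j = "\<lambda>(i, j, a). (a + j, a, i - a)" and i = "\<lambda>(u, a, b). (a + b, u - a, a)"])
       (auto simp: algebra_simps)
  also have "\<dots> = (\<Sum>u\<le>r. \<Sum>a\<le>u. \<Sum>b\<le>r - u. D a (F $ (u - a)) * D b (G $ (r - u - b)))"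
    by (simp add: sum.Sigma sum.cartesian_product)
  also have "\<dots> = (ext F * ext G) $ r"
    by (simp add: ext_def fps_mult_nth atLeast0AtMost sum_product)
  finally show "ext (F * G) $ r = (ext F * ext G) $ r" .
qed

lemma ext_power: "coeffs_in F \<Longrightarrow> ext (F ^ m) = ext F ^ m"
  by (induction m) (auto simp: ext_1 ext_mult coeffs_in_power)

lemma ext_prod: "(\<And>i. i \<in> I \<Longrightarrow> coeffs_in (F i)) \<Longrightarrow> ext (prod F I) = (\<Prod>i\<in>I. ext (F i))"
  by (induction I rule: infinite_finite_induct) (auto simp: ext_1 ext_mult coeffs_in_prod)

text \<open>Modulo the lower coefficients, \<open>ext\<close> is the identity, because \<open>D\<^sub>0\<close> is.\<close>

lemma ext_inject:
  assumes "ext F = ext G" and F: "coeffs_in F" and G: "coeffs_in G"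
  shows "F = G"
proof (rule fps_ext)
  fix r show "F $ r = G $ r"
  proof (induction r rule: less_induct)
    case (less r)
    \<comment> \<open>The leading part of \<open>ext\<close>, separated from the part that only involves lower coefficients.\<close>
    have split: "ext H $ r = H $ r + (\<Sum>i\<in>{1..r}. D i (H $ (r - i)))" if "coeffs_in H" for H
    proof -
      have "{..r} = insert 0 {1..r}" by auto
      then show ?thesis using that by (simp add: ext_def coeffs_in_def D_0)
    qed
    have "(\<Sum>i\<in>{1..r}. D i (F $ (r - i))) = (\<Sum>i\<in>{1..r}. D i (G $ (r - i)))"
      by (rule sum.cong) (use less.IH in auto)
    with split[OF F] split[OF G] assms(1) show ?case by simp
  qed
qed

end

section \<open>The inverse of the substitution \<open>x \<mapsto> x - x\<^sup>p t\<close>\<close>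

definition repunit :: "nat \<Rightarrow> nat \<Rightarrow> nat" where
  "repunit b k = (\<Sum>i<k. b ^ i)"

lemma repunit_Suc: "repunit b (Suc k) = repunit b k + b ^ k"
  by (simp add: repunit_def)

lemma repunit_0 [simp]: "repunit b 0 = 0"
  by (simp add: repunit_def)

lemma repunit_ge: "b \<ge> 1 \<Longrightarrow> k \<le> repunit b k"
proof (induction k)
  case (Suc k)
  then have "b ^ k \<ge> 1" by simp
  moreover have "k \<le> repunit b k" using Suc by simp
  ultimately show ?case by (simp only: repunit_Suc)
qed simp

lemma repunit_inject: 
  assumes "b \<ge> 1"
  shows "repunit b k = repunit b l \<longleftrightarrow> k = l"
proof -
  have "strict_mono (repunit b)"
    using assms by (simp add: strict_mono_Suc_iff repunit_Suc)
  then show ?thesis by (rule strict_mono_eq)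
qed

lemma power_eq_repunit: "b \<ge> 1 \<Longrightarrow> b ^ k = (b - 1) * repunit b k + 1"
proof (induction k)
  case (Suc k)
  from Suc have "b ^ Suc k = b ^ k + (b - 1) * b ^ k" by (cases b) auto
  with Suc show ?case by (simp add: repunit_Suc algebra_simps)
qed simp

lemma even_repunit_iff: "odd b \<Longrightarrow> even (repunit b k) \<longleftrightarrow> even k"
  by (induction k) (auto simp: repunit_Suc)

text \<open>The series \<open>\<Sum>\<^sub>k x^(p^k) t^[k]\<close>, where \<open>[k]\<close> is \<open>repunit p k\<close>. For \<open>p \<ge> 1\<close> the exponents are
  distinct and \<open>k \<le> [k]\<close>, so the finite sum has at most one nonzero term and misses none.\<close>

definition frobenius_series :: "nat \<Rightarrow> 'a::comm_ring_1 \<Rightarrow> 'a fps" where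
  "frobenius_series p x = Abs_fps (\<lambda>e. \<Sum>k\<le>e. if repunit p k = e then x ^ (p ^ k) else 0)"

lemma frobenius_series_nth_repunit:
  assumes "p \<ge> 1"
  shows "frobenius_series p x $ repunit p k = x ^ (p ^ k)"
  using repunit_ge[OF assms, of k] by (simp add: frobenius_series_def repunit_inject[OF assms])

lemma frobenius_series_nth_nonzero:
  "frobenius_series p x $ e \<noteq> 0 \<Longrightarrow> \<exists>k. e = repunit p k"
  by (auto simp: frobenius_series_def elim!: sum.not_neutral_contains_not_neutral split: if_splits)

text \<open>Since \<open>p^k = (p - 1) [k] + 1\<close>, the substitution \<open>t = s\<^sup>p\<^sup>-\<^sup>1\<close> and a factor \<open>s\<close> turn the exponents
  \<open>[k]\<close> into the powers of \<open>p\<close>.\<close>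

lemma additive_frobenius_series:
  fixes x :: "'a::comm_ring_1"
  assumes "p \<ge> 2"
  defines "g \<equiv> fps_X * (frobenius_series p x oo fps_X ^ (p - 1))"
  shows "g $ (p ^ k) = x ^ (p ^ k)" and "g $ e \<noteq> 0 \<Longrightarrow> \<exists>k. e = p ^ k"
proof -
  have p1: "p \<ge> 1" and pm: "p - 1 > 0" using assms(1) by simp_all
  have g: "g $ e = (if e \<noteq> 0 \<and> p - 1 dvd e - 1 then frobenius_series p x $ ((e - 1) div (p - 1)) else 0)" for e
    unfolding g_def by (auto simp: fps_nth_compose_X_power)
  have pk: "p ^ k - 1 = (p - 1) * repunit p k" using power_eq_repunit[OF p1, of k] by simp
  show "g $ (p ^ k) = x ^ (p ^ k)"
    unfolding g pk using pm by (simp add: frobenius_series_nth_repunit[OF p1])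
  assume "g $ e \<noteq> 0"
  then have e: "e \<noteq> 0" "p - 1 dvd e - 1" "frobenius_series p x $ ((e - 1) div (p - 1)) \<noteq> 0"
    unfolding g by (auto split: if_splits)
  then obtain k where "(e - 1) div (p - 1) = repunit p k" using frobenius_series_nth_nonzero by blast
  with e(2) have "e - 1 = (p - 1) * repunit p k" by (metis dvd_mult_div_cancel)
  with e(1) have "e = p ^ k" using power_eq_repunit[OF p1, of k] by simp
  then show "\<exists>k. e = p ^ k" ..
qed

context hasse_schmidt
begin

lemma coeffs_in_frobenius_series: "x \<in> A \<Longrightarrow> coeffs_in (frobenius_series p x)"
  by (auto simp: coeffs_in_def frobenius_series_def intro!: sum_closed power_closed zero_closed)

text \<open>The homomorphism sends \<open>x\<close> to \<open>x - x\<^sup>p t\<close>, hence \<open>x^(p^k)\<close> to \<open>x^(p^k) - x^(p^(k+1)) t^(p^k)\<close>.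
  Because \<open>[k] + p^k = [k+1]\<close>, the image of \<open>x^(p^k) t^[k]\<close> is the difference of two consecutive terms of the
  series.\<close>

lemma ext_frobenius_series:
  assumes p: "prime CHAR('a)" "p = CHAR('a)" and odd: "odd p"
    and x: "x \<in> A" and D1: "D 1 x = - (x ^ p)" and D2: "\<And>r. r > 1 \<Longrightarrow> D r x = 0"
  shows "ext (frobenius_series p x) = fps_const x"
proof (rule fps_ext)
  fix r
  have p1: "p \<ge> 1" and p0: "p > 0" using prime_gt_0_nat[OF p(1)] p(2) by simp_all
  have "ext (fps_const x) = fps_const x + fps_const (- (x ^ p)) * fps_X"
    unfolding ext_const
  proof (rule fps_ext)
    fix r show "Abs_fps (\<lambda>r. D r x) $ r = (fps_const x + fps_const (- (x ^ p)) * fps_X) $ r"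
      using D1 D2[of r] D_0[OF x] by (cases "r = 0"; cases "r = 1") auto
  qed
  then have ext_power: "ext (fps_const (x ^ (p ^ k)))
      = fps_const (x ^ (p ^ k)) - fps_const (x ^ (p ^ Suc k)) * fps_X ^ (p ^ k)" for k
  proof -
    assume ext_x: "ext (fps_const x) = fps_const x + fps_const (- (x ^ p)) * fps_X"
    have "ext (fps_const (x ^ (p ^ k))) = ext (fps_const x) ^ (p ^ k)"
      using ext_power[OF coeffs_in_const[OF x]] by (simp add: fps_const_power)
    also have "\<dots> = fps_const x ^ (p ^ k) + (fps_const (- (x ^ p)) * fps_X) ^ (p ^ k)"
      unfolding ext_x by (rule freshmans_dream'[where n = k]) (use p in simp_all)
    also have "(fps_const (- (x ^ p)) * fps_X) ^ (p ^ k) = fps_const (- (x ^ (p ^ Suc k))) * fps_X ^ (p ^ k)"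
      using odd by (simp add: power_mult_distrib fps_const_power power_minus_odd del: fps_const_neg flip: power_mult)
    finally show ?thesis by (simp add: fps_const_power flip: fps_const_neg)
  qed
  have D_pow: "D i (x ^ (p ^ k)) = (if i = 0 then x ^ (p ^ k) else if i = p ^ k then - (x ^ (p ^ Suc k)) else 0)" for i k
  proof -
    have "D i (x ^ (p ^ k)) = (fps_const (x ^ (p ^ k)) - fps_const (x ^ (p ^ Suc k)) * fps_X ^ (p ^ k)) $ i"
      using ext_power[of k] unfolding ext_const by (metis fps_nth_Abs_fps)
    then show ?thesis using p0 by (auto simp: fps_X_power_nth)
  qed
  \<comment> \<open>The contribution of the \<open>k\<close>-th term of the series to the coefficient at \<open>r\<close>.\<close>
  define z where "z k = (if repunit p k = r then x ^ (p ^ k) else 0)" for k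
  have orbit: "frobenius_series p x $ (r - i) = (\<Sum>k\<le>r. if repunit p k = r - i then x ^ (p ^ k) else 0)" for i
    unfolding frobenius_series_def fps_nth_Abs_fps
  proof (rule sum.mono_neutral_left)
    show "\<forall>k\<in>{..r} - {..r - i}. (if repunit p k = r - i then x ^ (p ^ k) else 0) = 0"
      using repunit_ge[OF p1] by (metis Diff_iff atMost_iff)
  qed auto
  have "ext (frobenius_series p x) $ r = (\<Sum>i\<le>r. \<Sum>k\<le>r. if repunit p k = r - i then D i (x ^ (p ^ k)) else 0)"
    unfolding ext_def fps_nth_Abs_fps orbit
    by (subst D_sum) (auto simp: D_zero power_closed x zero_closed intro!: sum.cong)
  also have "\<dots> = (\<Sum>k\<le>r. \<Sum>i\<le>r. if repunit p k = r - i then D i (x ^ (p ^ k)) else 0)"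
    by (rule sum.swap)
  also have "\<dots> = (\<Sum>k\<le>r. z k - z (Suc k))"
  proof (rule sum.cong[OF refl])
    fix k
    have "(\<Sum>i\<le>r. if repunit p k = r - i then D i (x ^ (p ^ k)) else 0)
        = (\<Sum>i\<in>(if repunit p k \<le> r then {r - repunit p k} else {}). D i (x ^ (p ^ k)))"
      by (rule sum.mono_neutral_cong_right) (auto split: if_splits)
    also have "\<dots> = z k - z (Suc k)"
      using p0 by (auto simp: D_pow z_def repunit_Suc)
    finally show "(\<Sum>i\<le>r. if repunit p k = r - i then D i (x ^ (p ^ k)) else 0) = z k - z (Suc k)" .
  qed
  also have "\<dots> = z 0 - z (Suc r)"
    by (rule sum_telescope)
  also have "z (Suc r) = 0"
    using repunit_ge[OF p1, of "Suc r"] by (auto simp: z_def)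
  also have "z 0 - 0 = fps_const x $ r"
    by (auto simp: z_def)
  finally show "ext (frobenius_series p x) $ r = fps_const x $ r" .
qed

end

text \<open>The exponents correspond as \<open>p^n - 1 = (p - 1) n + (p - 1) ([n] - n)\<close>: the first summand comes from the
  factors \<open>s\<close> in the \<open>n\<close> rows, the second from \<open>t = s\<^sup>p\<^sup>-\<^sup>1\<close>.\<close>

lemma coeff_prod_frobenius_series:
  fixes x :: "nat \<Rightarrow> 'a::idom"
  assumes p: "prime CHAR('a)" "p = CHAR('a)" and odd: "odd p"
  shows "(\<Prod>i<n. frobenius_series p (x i) ^ (p - 1)) $ (repunit p n - n)
       = det (mat n n (\<lambda>(i, k). x i ^ (p ^ k))) ^ (p - 1)"
proof -
  let ?q = "p - 1"
  have p2: "p \<ge> 2" and p1: "p \<ge> 1" and q0: "?q > 0"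
    using prime_ge_2_nat[OF p(1)] p(2) by simp_all
  have X0: "(fps_X ^ ?q :: 'a fps) $ 0 = 0" using q0 by simp
  define L where "L i = fps_X * (frobenius_series p (x i) oo fps_X ^ ?q)" for i
  have "additive_fps (L i)" for i
    unfolding additive_fps_def L_def p(2)[symmetric]
    using additive_frobenius_series(2)[OF p2] by blast
  then have "coeff_eq_det_power n L"
    using coeff_eq_det_power_if_additive p odd by metis
  then have "(\<Prod>i<n. L i ^ ?q) $ (p ^ n - 1) = det (mat n n (\<lambda>(i, k). L i $ (p ^ k))) ^ ?q"
    unfolding coeff_eq_det_power_def p(2) .
  also have "mat n n (\<lambda>(i, k). L i $ (p ^ k)) = mat n n (\<lambda>(i, k). x i ^ (p ^ k))"
    unfolding L_def additive_frobenius_series(1)[OF p2] ..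
  also have "(\<Prod>i<n. L i ^ ?q) = (\<Prod>i<n. fps_X ^ ?q * ((frobenius_series p (x i) ^ ?q) oo fps_X ^ ?q))"
    by (simp only: L_def power_mult_distrib fps_compose_power[OF X0])
  also have "\<dots> = fps_X ^ (?q * n) * ((\<Prod>i<n. frobenius_series p (x i) ^ ?q) oo fps_X ^ ?q)"
    by (simp only: prod.distrib fps_compose_prod_distrib[OF X0] power_mult prod_constant card_lessThan)
  also have "p ^ n - 1 = ?q * n + ?q * (repunit p n - n)"
    by (simp only: power_eq_repunit[OF p1] add_diff_cancel_right' distrib_left[symmetric]
          le_add_diff_inverse[OF repunit_ge[OF p1]])
  also have "(fps_X ^ (?q * n) * ((\<Prod>i<n. frobenius_series p (x i) ^ ?q) oo fps_X ^ ?q)) $ \<dots>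
      = (\<Prod>i<n. frobenius_series p (x i) ^ ?q) $ (repunit p n - n)"
    using q0 by (simp add: fps_X_power_mult_nth fps_nth_compose_X_power)
  finally show ?thesis .
qed

section \<open>Steenrod powers\<close>

lemma CHAR_mpoly: "CHAR('p::prime_card mpoly) = CARD('p)"
proof -
  have "of_nat k = (0 :: 'p mpoly) \<longleftrightarrow> CARD('p) dvd k" for k
  proof -
    have "of_nat k = (0 :: 'p mpoly) \<longleftrightarrow> (of_nat k :: 'p mod_ring) = 0"
    proof
      assume "of_nat k = (0 :: 'p mpoly)"
      then have "Poly_Mapping.lookup (of_nat k :: 'p mpoly) 0 = 0" by simp
      then show "(of_nat k :: 'p mod_ring) = 0" by (simp add: lookup_of_nat)
    next
      assume "(of_nat k :: 'p mod_ring) = 0"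
      then show "of_nat k = (0 :: 'p mpoly)" by (simp flip: single_of_nat)
    qed
    then show ?thesis by (simp add: of_nat_eq_0_iff_char_dvd)
  qed
  then show ?thesis by (intro CHAR_eqI) auto
qed

lemma St_0: "St 0 = 1"
  unfolding St_def one_steenrod_def
  by (simp add: steenrod.abs_eq_iff adem_rel_def adem_ideal.unit)

lemma w_eq_det: "(w n :: 'p::prime_card mpoly) = det (mat n n (\<lambda>(i, k). X (i + 1) ^ (CARD('p) ^ k)))"
proof -
  let ?A = "mat n n (\<lambda>(i, k). X (i + 1) ^ (CARD('p) ^ k)) :: 'p mpoly mat"
  have "det (transpose_mat ?A) = det ?A"
    by (rule det_transpose) auto
  moreover have "transpose_mat ?A = mat n n (\<lambda>(i, j). X (j + 1) ^ (CARD('p) ^ i))"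
    by (rule eq_matI) auto
  ultimately show ?thesis unfolding w_def by simp
qed

lemma Const_minus_1: "Const (- 1) = (- 1 :: 'p::prime_card mpoly)"
  by (simp add: Const_def single_uminus)

lemma poly_alg_mult: "f \<in> poly_alg n \<Longrightarrow> g \<in> poly_alg n \<Longrightarrow> f * g \<in> (poly_alg n :: 'p::prime_card mpoly set)"
proof -
  assume f: "f \<in> poly_alg n" and g: "g \<in> poly_alg n"
  show "f * g \<in> poly_alg n"
    unfolding poly_alg_def
  proof (intro CollectI ballI)
    fix m assume "m \<in> Poly_Mapping.keys (f * g)"
    then obtain a b where "m = a + b" "a \<in> Poly_Mapping.keys f" "b \<in> Poly_Mapping.keys g"
      using keys_mult[of f g] by blast
    then show "Poly_Mapping.keys m \<subseteq> {1..n}"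
      using f g keys_add[of a b] unfolding poly_alg_def by blast
  qed
qed

lemma poly_alg_add: "f \<in> poly_alg n \<Longrightarrow> g \<in> poly_alg n \<Longrightarrow> f + g \<in> (poly_alg n :: 'p::prime_card mpoly set)"
  using keys_add[of f g] unfolding poly_alg_def by blast

lemma Const_in_poly_alg: "Const c \<in> (poly_alg n :: 'p::prime_card mpoly set)"
  by (auto simp: poly_alg_def Const_def split: if_splits)

lemma X_in_poly_alg: "i \<in> {1..n} \<Longrightarrow> X i \<in> (poly_alg n :: 'p::prime_card mpoly set)"
  by (auto simp: poly_alg_def X_def split: if_splits)

lemma one_in_poly_alg: "1 \<in> (poly_alg n :: 'p::prime_card mpoly set)"
  using Const_in_poly_alg[of 1] by (simp add: Const_def)

text \<open>Signs are scalars, so that \<open>act_scale\<close> applies to them.\<close>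

lemma minus_one_power_eq_Const: "(- 1) ^ r = (Const ((- 1) ^ r) :: 'p::prime_card mpoly)"
  by (cases "even r") (auto simp: Const_minus_1, simp add: Const_def)

context steenrod_action
begin

lemma act_sign: "f \<in> poly_alg n \<Longrightarrow> act a ((- 1) ^ r * f) = (- 1) ^ r * act a f"
  unfolding minus_one_power_eq_Const by (rule act_scale)

lemma act_zero: "f \<in> poly_alg n \<Longrightarrow> act 0 f = 0"
  using add_act[of f 0 0] unfolding add_0_left by (metis add_cancel_right_right)

lemma act_sum: "f \<in> poly_alg n \<Longrightarrow> act (\<Sum>i\<in>I. a i) f = (\<Sum>i\<in>I. act (a i) f)"
  by (induction I rule: infinite_finite_induct) (auto simp: act_zero add_act)

text \<open>The sign makes the series \<open>\<Sum>\<^sub>k x^(p^k) t^[k]\<close>, without signs, the preimage of \<open>x\<close>.\<close>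

sublocale hasse_schmidt "poly_alg n :: 'p mpoly set" "\<lambda>r f. (- 1) ^ r * act (St r) f"
proof
  show "(0 :: 'p mpoly) \<in> poly_alg n" by (simp add: poly_alg_def)
  show "(1 :: 'p mpoly) \<in> poly_alg n" by (rule one_in_poly_alg)
  fix f g :: "'p mpoly" assume f: "f \<in> poly_alg n"
  show "(- 1) ^ 0 * act (St 0) f = f"
    using f by (simp add: St_0 one_act)
  assume g: "g \<in> poly_alg n"
  show "f + g \<in> poly_alg n" "f * g \<in> poly_alg n"
    using f g by (auto intro: poly_alg_add poly_alg_mult)
  fix r
  show "(- 1) ^ r * act (St r) (f + g) = (- 1) ^ r * act (St r) f + (- 1) ^ r * act (St r) g"
    using f g by (simp add: act_add distrib_left)
  have "(- 1) ^ s * act (St s) f * ((- 1) ^ (r - s) * act (St (r - s)) g)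
      = (- 1) ^ r * (act (St s) f * act (St (r - s)) g)" if "s \<le> r" for s
  proof -
    have "(- 1) ^ r = (- 1 :: 'p mpoly) ^ s * (- 1) ^ (r - s)"
      using that by (simp flip: power_add)
    then show ?thesis by (simp only: mult_ac)
  qed
  then show "(- 1) ^ r * act (St r) (f * g)
      = (\<Sum>s\<le>r. (- 1) ^ s * act (St s) f * ((- 1) ^ (r - s) * act (St (r - s)) g))"
    unfolding cartan[OF f g] sum_distrib_left by (intro sum.cong refl) (simp only: atMost_iff)
next
  show "(- 1) ^ r * act (St r) 1 = 0" if "r > 0" for r
    using that by (simp add: P_one)
qed

text \<open>At \<open>r > 0\<close> the coefficient is \<open>(-1)\<^sup>r \<Sum>\<^sub>i P\<^sup>i \<chi>(P\<^sup>r\<^sup>-\<^sup>i) f\<close>, which is the recursion that determines \<open>\<chi>\<close>.\<close>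

lemma ext_conjugate:
  assumes "canonical_antiautomorphism \<chi>" and f: "f \<in> poly_alg n"
  shows "ext (Abs_fps (\<lambda>r. (- 1) ^ r * act (\<chi> (St r)) f)) = fps_const f"
proof (rule fps_ext)
  interpret canonical_antiautomorphism \<chi> by fact
  fix r
  have "(- 1) ^ i * act (St i) ((- 1) ^ (r - i) * act (\<chi> (St (r - i))) f)
      = (- 1) ^ r * act (St i * \<chi> (St (r - i))) f" if "i \<le> r" for i
  proof -
    have "(- 1) ^ r = (- 1 :: 'p mpoly) ^ i * (- 1) ^ (r - i)"
      using that by (simp flip: power_add)
    then show ?thesis using f by (simp add: act_sign act_closed mult_act mult.assoc)
  qed
  then have "ext (Abs_fps (\<lambda>r. (- 1) ^ r * act (\<chi> (St r)) f)) $ r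
      = (- 1) ^ r * act (\<Sum>i\<le>r. St i * \<chi> (St (r - i))) f"
    using f by (simp add: ext_def act_sum sum_distrib_left)
  also have "\<dots> = fps_const f $ r"
  proof (cases "r = 0")
    case True
    then show ?thesis using f by (simp add: St_0 chi_one one_act)
  next
    case False
    then show ?thesis using f by (simp add: chi_P act_zero)
  qed
  finally show "ext (Abs_fps (\<lambda>r. (- 1) ^ r * act (\<chi> (St r)) f)) $ r = fps_const f $ r" .
qed

text \<open>Both sides are coefficients of series that \<open>ext\<close> maps to the given power of a product of variables: the left
  one by \<open>ext_conjugate\<close>, the right one because \<open>ext\<close> is multiplicative and maps the series of \<open>x\<^sub>i\<close> to
  \<open>x\<^sub>i\<close>. As \<open>ext\<close> is injective, the series agree; this replaces a Cartan formula for \<open>\<chi>(P\<^sup>r)\<close>.\<close>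

lemma act_conjugate_monomial:
  assumes chi: "canonical_antiautomorphism \<chi>" and odd: "odd CARD('p)"
    and I: "I \<subseteq> {1..n}"
  shows "(- 1) ^ r * act (\<chi> (St r)) ((\<Prod>i\<in>I. X i) ^ m)
      = (\<Prod>i\<in>I. frobenius_series CARD('p) (X i) ^ m) $ r"
proof -
  let ?p = "CARD('p)"
  let ?f = "(\<Prod>i\<in>I. X i) ^ m :: 'p mpoly"
  let ?Y = "\<Prod>i\<in>I. frobenius_series ?p (X i :: 'p mpoly) ^ m"
  have f: "?f \<in> poly_alg n"
    using I by (intro power_closed prod_closed X_in_poly_alg) auto
  have Y: "coeffs_in ?Y"
    using I by (intro coeffs_in_prod coeffs_in_power coeffs_in_frobenius_series X_in_poly_alg) auto
  have orbit: "ext (frobenius_series ?p (X i)) = fps_const (X i)" if "i \<in> I" for i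
  proof (rule ext_frobenius_series)
    show "(X i :: 'p mpoly) \<in> poly_alg n" using that I by (intro X_in_poly_alg) blast
    show "(- 1) ^ 1 * act (St 1) (X i) = - (X i ^ ?p)"
      using that I by (subst P1_X) (blast, simp)
    show "(- 1) ^ r * act (St r) (X i) = 0" if "r > 1" for r
      using \<open>i \<in> I\<close> I that by (subst P_X) (blast, simp_all)
  qed (use odd prime_card[where ?'a = 'p] in \<open>simp_all add: CHAR_mpoly\<close>)
  have "ext ?Y = (\<Prod>i\<in>I. ext (frobenius_series ?p (X i)) ^ m)"
    using I by (subst ext_prod) (auto intro!: prod.cong ext_power coeffs_in_power coeffs_in_frobenius_series X_in_poly_alg)
  also have "\<dots> = (\<Prod>i\<in>I. fps_const (X i) ^ m)"
    by (simp add: orbit)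
  also have "\<dots> = fps_const ?f"
    by (simp only: fps_const_power[symmetric] fps_const_prod prod_power_distrib)
  also have "\<dots> = ext (Abs_fps (\<lambda>r. (- 1) ^ r * act (\<chi> (St r)) ?f))"
    by (rule ext_conjugate[OF chi f, symmetric])
  finally have "?Y = Abs_fps (\<lambda>r. (- 1) ^ r * act (\<chi> (St r)) ?f)"
    by (rule ext_inject) (use Y f in \<open>auto simp: coeffs_in_def minus_one_power_eq_Const
          intro!: act_closed poly_alg_mult Const_in_poly_alg\<close>)
  then show ?thesis by simp
qed

end

theorem theorem1p1:
  fixes p n p_n :: nat
    and act :: "'p::prime_card steenrod \<Rightarrow> 'p mpoly \<Rightarrow> 'p mpoly"
    and \<chi> :: "'p steenrod \<Rightarrow> 'p steenrod"
  assumes "p = CARD('p)" and "odd p" and "n \<ge> 1"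
    and "steenrod_action n act"
    and "canonical_antiautomorphism \<chi>"
    and "p_n = (p ^ n - 1) div (p - 1)"
  shows "act (\<chi> (St (p_n - n))) ((\<Prod>i=1..n. X i) ^ (p - 1)) = w n ^ (p - 1)"
proof -
  interpret steenrod_action n act by fact
  have prime: "prime p" using prime_card[where ?'a = 'p] assms(1) by simp
  then have p1: "p \<ge> 1" and p2: "p - 1 > 0" using prime_ge_2_nat[of p] by simp_all
  have p_n: "p_n = repunit p n"
    unfolding assms(6) using p2 by (simp add: power_eq_repunit[OF p1, of n])
  have "even (repunit p n - n)"
    using repunit_ge[OF p1, of n] even_repunit_iff[OF assms(2), of n] by simp
  then have "act (\<chi> (St (p_n - n))) ((\<Prod>i=1..n. X i) ^ (p - 1))
      = (- 1) ^ (repunit p n - n) * act (\<chi> (St (repunit p n - n))) ((\<Prod>i=1..n. X i) ^ (p - 1))"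
    by (simp add: p_n)
  also have "\<dots> = (\<Prod>i=1..n. frobenius_series p (X i) ^ (p - 1)) $ (repunit p n - n)"
    using act_conjugate_monomial[OF assms(5)] assms(1,2) by simp
  also have "(\<Prod>i=1..n. frobenius_series p (X i) ^ (p - 1)) = (\<Prod>i<n. frobenius_series p (X (i + 1) :: 'p mpoly) ^ (p - 1))"
    by (rule prod.reindex_bij_witness[where i = Suc and j = "\<lambda>i. i - 1"]) auto
  also have "\<dots> $ (repunit p n - n) = det (mat n n (\<lambda>(i, k). X (i + 1) ^ (p ^ k))) ^ (p - 1)"
    by (rule coeff_prod_frobenius_series) (use prime assms(1,2) in \<open>simp_all add: CHAR_mpoly\<close>)
  also have "\<dots> = w n ^ (p - 1)"
    by (simp add: w_eq_det assms(1))
  finally show ?thesis .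
qed

end
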